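(* Let $\mathcal{B}=B(F)\subseteq 2^{[n]}$ be a principal Borel set with Borel generator $F=\{i_1<i_2<\cdots<i_d\}$, and let $\Delta$ be the simplicial complex on $[n]$ with $\mathcal{F}(\Delta)=\mathcal{B}$. Then $B(\Delta)=A(\Delta)$.
   Context: Let $K$ be a field, $[n]=\{1,\ldots,n\}$ and $S=K[x_1,\ldots,x_n]$. A subset $\mathcal{B}\subseteq 2^{[n]}$ is Borel if whenever $F\in\mathcal{B}$, $i<j$, $i\in[n]\setminus F$ and $j\in F$, then $(F\setminus\{j\})\cup\{i\}\in\mathcal{B}$. $B(F)$ denotes the smallest Borel subset of $2^{[n]}$ containing $F$; such Borel sets are called principal, with Borel generator $F$. $\mathcal{F}(\Delta)$ is the set of facets (maximal faces) of $\Delta$. For $k\ge 0$, a $k$-cover of $\Delta$ is a nonzero vector $c\in\mathbb{Z}_{\ge 0}^n$ with $\sum_{i\in G}c_i\ge k$ for every facet $G$; it is squarefree if all $c_i\le 1$. Write $x^c=x_1^{c_1}\cdots x_n^{c_n}$. For $k\ge 1$, $J_k(\Delta)\subseteq S$ is the ideal spanned over $K$ by the monomials $x^c$ with $c$ a $k$-cover, $J_0(\Delta)=S$, and $A(\Delta)=\bigoplus_{k\ge 0}J_k(\Delta)t^k\subseteq S[t]$. $B(\Delta)\subseteq S[t]$ (for a simplicial complex $\Delta$) is the $S$-subalgebra generated by all $x^ct^k$ with $k\ge 1$ and $c$ a squarefree $k$-cover of $\Delta$. *)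

theory Defs
  imports "HOL-Library.Poly_Mapping" "HOL-Computational_Algebra.Polynomial"
begin

section \<open>Borel sets and simplicial complexes on \<open>[n] = {1..n}\<close>\<close>

definition borel_set :: "nat \<Rightarrow> nat set set \<Rightarrow> bool" where
  "borel_set n \<B> \<longleftrightarrow> \<B> \<subseteq> Pow {1..n} \<and>
     (\<forall>F\<in>\<B>. \<forall>i\<in>{1..n} - F. \<forall>j\<in>F. i < j \<longrightarrow> insert i (F - {j}) \<in> \<B>)"

definition principal_borel :: "nat \<Rightarrow> nat set \<Rightarrow> nat set set" where
  "principal_borel n F = borel_set n hull {F}"

(* Not every i in [n] is required to be a vertex: a principal Borel set B(F) only covers
   the elements of [n] up to the maximum of F. *)
definition simplicial_complex_on :: "nat \<Rightarrow> nat set set \<Rightarrow> bool" where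
  "simplicial_complex_on n \<Delta> \<longleftrightarrow> \<Delta> \<subseteq> Pow {1..n} \<and> (\<forall>G\<in>\<Delta>. \<forall>H. H \<subseteq> G \<longrightarrow> H \<in> \<Delta>)"

definition facets :: "nat set set \<Rightarrow> nat set set" where
  "facets \<Delta> = {G \<in> \<Delta>. \<forall>H\<in>\<Delta>. G \<subseteq> H \<longrightarrow> H = G}"

section \<open>Vertex covers\<close>

(* Vectors of nonnegative integers indexed by [n] are the finitely supported functions
   whose support lies in {1..n}, so that they are exponent vectors as well. *)
definition k_cover :: "nat \<Rightarrow> nat set set \<Rightarrow> nat \<Rightarrow> (nat \<Rightarrow>\<^sub>0 nat) \<Rightarrow> bool" where
  "k_cover n \<Delta> k c \<longleftrightarrow> Poly_Mapping.keys c \<subseteq> {1..n} \<and> c \<noteq> 0 \<and>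
     (\<forall>G\<in>facets \<Delta>. k \<le> (\<Sum>i\<in>G. Poly_Mapping.lookup c i))"

definition squarefree_vec :: "(nat \<Rightarrow>\<^sub>0 nat) \<Rightarrow> bool" where
  "squarefree_vec c \<longleftrightarrow> (\<forall>i. Poly_Mapping.lookup c i \<le> 1)"

section \<open>The polynomial rings \<open>S = K[x\<^sub>1, \<dots>, x\<^sub>n]\<close> and \<open>S[t]\<close>\<close>

(* Polynomials over 'k in the variables x_i, i any natural number: the multiplication of
   poly_mapping is convolution with respect to addition of exponent vectors. *)
type_synonym 'k mpoly_nat = "(nat \<Rightarrow>\<^sub>0 nat) \<Rightarrow>\<^sub>0 'k"

definition poly_ring :: "nat \<Rightarrow> 'k::field mpoly_nat set" where
  "poly_ring n = {p. \<forall>m\<in>Poly_Mapping.keys p. Poly_Mapping.keys m \<subseteq> {1..n}}"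

definition poly_ring_t :: "nat \<Rightarrow> 'k::field mpoly_nat poly set" where
  "poly_ring_t n = {f. \<forall>k. coeff f k \<in> poly_ring n}"

definition x_pow :: "(nat \<Rightarrow>\<^sub>0 nat) \<Rightarrow> 'k::field mpoly_nat" where
  "x_pow c = Poly_Mapping.single c 1"

definition scale_mpoly :: "'k::field \<Rightarrow> 'k mpoly_nat \<Rightarrow> 'k mpoly_nat" where
  "scale_mpoly a p = Poly_Mapping.map ((*) a) p"

interpretation mpoly_vs: vector_space scale_mpoly
  by unfold_locales
    (simp_all add: scale_mpoly_def mult_map_scale_conv_mult distrib_left distrib_right
      single_add mult_single flip: mult.assoc)

section \<open>The algebras \<open>A(\<Delta>)\<close> and \<open>B(\<Delta>)\<close>\<close>

definition cover_ideal :: "nat \<Rightarrow> nat set set \<Rightarrow> nat \<Rightarrow> 'k::field mpoly_nat set" where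
  "cover_ideal n \<Delta> k =
     (if k = 0 then poly_ring n else module.span scale_mpoly {x_pow c | c. k_cover n \<Delta> k c})"

(* The direct sum of the J_k t^k inside S[t]: f = sum_k f_k t^k lies in it iff every f_k
   lies in J_k. *)
definition cover_algebra :: "nat \<Rightarrow> nat set set \<Rightarrow> 'k::field mpoly_nat poly set" where
  "cover_algebra n \<Delta> = {f. \<forall>k. coeff f k \<in> cover_ideal n \<Delta> k}"

definition subalgebra_of_poly_ring_t :: "nat \<Rightarrow> 'k::field mpoly_nat poly set \<Rightarrow> bool" where
  "subalgebra_of_poly_ring_t n X \<longleftrightarrow> X \<subseteq> poly_ring_t n \<and> 1 \<in> X \<and>
     (\<forall>f\<in>X. \<forall>g\<in>X. f + g \<in> X \<and> f * g \<in> X) \<and> (\<forall>a\<in>poly_ring n. \<forall>f\<in>X. smult a f \<in> X)"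

definition squarefree_cover_algebra :: "nat \<Rightarrow> nat set set \<Rightarrow> 'k::field mpoly_nat poly set" where
  "squarefree_cover_algebra n \<Delta> = subalgebra_of_poly_ring_t n hull
     {monom (x_pow c) k | c k. 1 \<le> k \<and> k_cover n \<Delta> k c \<and> squarefree_vec c}"

end

theory Submission
  imports Defs
begin

text \<open>
  The algebra \<open>A(\<Delta>)\<close> is spanned by the monomials \<open>x\<^sup>c t\<^sup>k\<close> with \<open>k \<le> o(c)\<close>, where \<open>o(c)\<close> is the
  minimum of \<open>c(G) = (\<Sum>i\<in>G. c i)\<close> over the facets \<open>G\<close>. A vector \<open>c\<close> is the sum of the indicator
  vectors \<open>e\<^sub>s\<close> of its level sets \<open>{i. s < c i}\<close>, \<open>s = 0, 1, 2, \<dots>\<close>, so \<open>x\<^sup>c t\<^sup>k\<close> is a product of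
  squarefree generators as soon as \<open>o(c) = (\<Sum>s. o(e\<^sub>s))\<close>. In general only \<open>\<ge>\<close> holds; equality
  means that one single facet minimizes \<open>c\<close> and all the \<open>e\<^sub>s\<close> at once.

  This is what the greedy algorithm gives for the bases of a matroid: which bases have minimal
  weight \<open>c\<close> depends only on the order in which \<open>c\<close> puts the elements, and they meet each level set
  in as few elements as possible (\<open>min_weight_basis_min_level\<close>). A principal Borel set is the set of bases of
  a matroid. Indeed \<open>B(F)\<close> consists of the sets \<open>G\<close> of the size of \<open>F\<close> such that each initial
  segment of \<open>[n]\<close> contains at least as many elements of \<open>G\<close> as of \<open>F\<close>
  (\<open>principal_borel_eq_dominating\<close>), and the basis exchange property can be read off from this
  description (\<open>dominating_exchange\<close>).
\<close>

section \<open>Principal Borel sets satisfy the basis exchange property\<close>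

text \<open>
  For \<open>G = {j\<^sub>1 < \<dots> < j\<^sub>d}\<close> and \<open>F = {i\<^sub>1 < \<dots> < i\<^sub>d}\<close> this is the componentwise order \<open>j\<^sub>l \<le> i\<^sub>l\<close>.
  It is expressed by counting, because replacing one element changes the count in any set by at
  most one (\<open>card_swap_Int\<close>).
\<close>

definition dominating :: "nat \<Rightarrow> nat set \<Rightarrow> nat set set" where
  "dominating n F = {G. G \<subseteq> {1..n} \<and> card G = card F \<and>
     (\<forall>m. card (F \<inter> {..m}) \<le> card (G \<inter> {..m}))}"

lemma card_swap_Int:
  fixes F A :: "'a set"
  assumes "finite F" "j \<in> F" "i \<notin> F"
  shows "card (insert i (F - {j}) \<inter> A) + of_bool (j \<in> A) = card (F \<inter> A) + of_bool (i \<in> A)"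
proof -
  have "card (insert i (F - {j}) \<inter> A) = card ((F \<inter> A) - {j}) + of_bool (i \<in> A)"
  proof (cases "i \<in> A")
    case True
    then have "insert i (F - {j}) \<inter> A = insert i ((F \<inter> A) - {j})" by auto
    then show ?thesis using True assms by simp
  next
    case False
    then have "insert i (F - {j}) \<inter> A = (F \<inter> A) - {j}" by auto
    then show ?thesis using False by simp
  qed
  moreover have "card ((F \<inter> A) - {j}) + of_bool (j \<in> A) = card (F \<inter> A)"
  proof (cases "j \<in> A")
    case True
    then have "j \<in> F \<inter> A" using assms by simp
    then show ?thesis using True assms card_Suc_Diff1[of "F \<inter> A" j] by simp
  next
    case False
    then show ?thesis by simp
  qed
  ultimately show ?thesis by simp
qed

lemma card_swap:
  fixes F :: "'a set"
  assumes "finite F" "j \<in> F" "i \<notin> F"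
  shows "card (insert i (F - {j})) = card F"
  using card_swap_Int[OF assms, of UNIV] by simp

lemma finite_dominating: "G \<in> dominating n F \<Longrightarrow> finite G"
  unfolding dominating_def using finite_subset by blast

lemma borel_set_dominating: "borel_set n (dominating n F)"
  unfolding borel_set_def
proof (intro conjI ballI impI)
  show "dominating n F \<subseteq> Pow {1..n}" by (auto simp: dominating_def)
next
  fix G i j assume G: "G \<in> dominating n F" and i: "i \<in> {1..n} - G" and j: "j \<in> G" and "i < j"
  have fin: "finite G" using G by (rule finite_dominating)
  have "card (F \<inter> {..m}) \<le> card (insert i (G - {j}) \<inter> {..m})" for m
  proof -
    have "card (F \<inter> {..m}) \<le> card (G \<inter> {..m})" using G by (simp add: dominating_def)
    then show ?thesis
      using card_swap_Int[OF fin j, of i "{..m}"] i \<open>i < j\<close> by (auto simp: of_bool_def split: if_splits)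
  qed
  then show "insert i (G - {j}) \<in> dominating n F"
    using G i j card_swap[OF fin j, of i] by (auto simp: dominating_def)
qed

text \<open>
  Moves of elements to the left transform \<open>F\<close> into any \<open>G\<close> that dominates it: move the smallest
  element of \<open>F - G\<close> to the position of the smallest element of \<open>G - F\<close>. The result is still
  dominated by \<open>G\<close> and has one more element in common with it.
\<close>

lemma dominating_subset_borel_set:
  assumes "borel_set n \<B>"
  shows "F \<in> \<B> \<Longrightarrow> G \<in> dominating n F \<Longrightarrow> G \<in> \<B>"
proof (induction "card (F - G)" arbitrary: F)
  case 0
  have "finite F" using 0 assms finite_subset[of F "{1..n}"] by (auto simp: borel_set_def)
  then have "F \<subseteq> G" using 0 by simp
  moreover have "card G = card F" using 0(3) by (simp add: dominating_def)
  moreover have "finite G" using 0(3) by (rule finite_dominating)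
  ultimately have "F = G" by (intro card_subset_eq) simp_all
  then show ?case using 0 by simp
next
  case (Suc N)
  have finF: "finite F"
    using Suc.prems assms finite_subset[of F "{1..n}"] by (auto simp: borel_set_def)
  have finG: "finite G" using Suc.prems(2) by (rule finite_dominating)
  have subG: "G \<subseteq> {1..n}" and card: "card G = card F"
    and dom: "\<And>m. card (F \<inter> {..m}) \<le> card (G \<inter> {..m})"
    using Suc.prems(2) by (simp_all add: dominating_def)
  have FG: "F - G \<noteq> {}" using Suc.hyps(2) by (metis card.empty nat.distinct(1))
  have GF: "G - F \<noteq> {}"
    using card_subset_eq[OF finF, of G] card FG by auto
  define i where "i = Min (G - F)"
  define j where "j = Min (F - G)"
  have i: "i \<in> G - F" and i_min: "\<And>x. x \<in> G - F \<Longrightarrow> i \<le> x"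
    using GF finG Min_in[of "G - F"] unfolding i_def by (blast, simp)
  have j: "j \<in> F - G" and j_min: "\<And>x. x \<in> F - G \<Longrightarrow> j \<le> x"
    using FG finF Min_in[of "F - G"] unfolding j_def by (blast, simp)
  have "i < j"
  proof (rule ccontr)
    assume "\<not> i < j"
    with i j have "j < i" by (metis DiffD1 DiffD2 linorder_neqE_nat)
    then have "G \<inter> {..j} \<subseteq> F \<inter> {..j}" using i_min by fastforce
    then have "G \<inter> {..j} \<subset> F \<inter> {..j}" using j by auto
    then have "card (G \<inter> {..j}) < card (F \<inter> {..j})"
      using finF by (simp add: psubset_card_mono)
    then show False using dom[of j] by simp
  qed
  let ?F' = "insert i (F - {j})"
  have "?F' \<in> \<B>"
    using assms Suc.prems(1) i j \<open>i < j\<close> subG unfolding borel_set_def by blast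
  moreover have "card (?F' \<inter> {..m}) \<le> card (G \<inter> {..m})" for m
  proof (cases "i \<le> m \<and> m < j")
    case True
    then have "F \<inter> {..m} \<subset> G \<inter> {..m}" using j_min i by fastforce
    then have "card (F \<inter> {..m}) < card (G \<inter> {..m})"
      using finG by (simp add: psubset_card_mono)
    then show ?thesis using card_swap_Int[of F j i "{..m}"] finF i j True by auto
  next
    case False
    then show ?thesis
      using card_swap_Int[of F j i "{..m}"] finF i j dom[of m] \<open>i < j\<close>
      by (auto simp: of_bool_def split: if_splits)
  qed
  then have "G \<in> dominating n ?F'"
    using subG card card_swap[of F j i] finF i j by (auto simp: dominating_def)
  moreover have "?F' - G = (F - G) - {j}" using i by auto
  then have "N = card (?F' - G)" using Suc.hyps(2) j finF by simp
  ultimately show ?case using Suc.hyps(1) by blast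
qed

lemma principal_borel_eq_dominating:
  assumes "F \<subseteq> {1..n}"
  shows "principal_borel n F = dominating n F"
proof
  have "F \<in> dominating n F" using assms by (simp add: dominating_def)
  then show "principal_borel n F \<subseteq> dominating n F"
    unfolding principal_borel_def by (intro hull_minimal borel_set_dominating) simp
  show "dominating n F \<subseteq> principal_borel n F"
    unfolding principal_borel_def hull_def using dominating_subset_borel_set by blast
qed

text \<open>
  If \<open>H - G\<close> contains an element below \<open>x\<close>, the Borel property allows to replace \<open>x\<close> by it.
  Otherwise \<open>x\<close> can be replaced by the smallest element \<open>y\<close> of \<open>H - G\<close>: only the segments
  \<open>{..m}\<close> with \<open>x \<le> m < y\<close> lose an element of \<open>G\<close>, and in these \<open>G\<close> contains \<open>H\<close> and also \<open>x\<close>, hence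
  has an element to spare.
\<close>

lemma dominating_exchange:
  assumes G: "G \<in> dominating n F" and H: "H \<in> dominating n F" and x: "x \<in> G - H"
  shows "\<exists>y\<in>H - G. insert y (G - {x}) \<in> dominating n F"
proof -
  have fin: "finite G" "finite H" using G H finite_dominating by auto
  have "card H = card G" using G H by (simp add: dominating_def)
  then have "H - G \<noteq> {}" using card_subset_eq[OF fin(1), of H] x by auto
  define y where "y = Min (H - G)"
  have y: "y \<in> H - G" and y_min: "\<And>z. z \<in> H - G \<Longrightarrow> y \<le> z"
    using \<open>H - G \<noteq> {}\<close> fin Min_in[of "H - G"] unfolding y_def by (blast, simp)
  have "y \<in> {1..n}" using y H by (auto simp: dominating_def)
  show ?thesis
  proof (cases "y < x")
    case True
    then show ?thesis
      using borel_set_dominating[of n F] G x y \<open>y \<in> {1..n}\<close> unfolding borel_set_def by blast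
  next
    case False
    have "card (F \<inter> {..m}) \<le> card (insert y (G - {x}) \<inter> {..m})" for m
    proof (cases "x \<le> m \<and> m < y")
      case True
      then have "H \<inter> {..m} \<subset> G \<inter> {..m}" using y_min x by fastforce
      then have "card (H \<inter> {..m}) < card (G \<inter> {..m})"
        using fin by (simp add: psubset_card_mono)
      moreover have "card (F \<inter> {..m}) \<le> card (H \<inter> {..m})" using H by (simp add: dominating_def)
      ultimately show ?thesis
        using card_swap_Int[of G x y "{..m}"] fin x y True by auto
    next
      case outside: False
      have "card (F \<inter> {..m}) \<le> card (G \<inter> {..m})" using G by (simp add: dominating_def)
      then show ?thesis
        using card_swap_Int[of G x y "{..m}"] fin x y outside False
        by (auto simp: of_bool_def split: if_splits)
    qed
    then have "insert y (G - {x}) \<in> dominating n F"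
      using G \<open>y \<in> {1..n}\<close> card_swap[of G x y] fin x y by (auto simp: dominating_def)
    then show ?thesis using y by blast
  qed
qed

section \<open>Bases of minimal weight\<close>

text \<open>
  Let \<open>A = {i. c i \<le> s}\<close> and suppose that \<open>H\<close> beats \<open>G\<close>, that is, meets \<open>A\<close> in more elements than
  \<open>G\<close>. Elements of \<open>H - G\<close> outside \<open>A\<close> can be exchanged for elements of \<open>G\<close> at no loss, so
  \<open>I - G \<subseteq> A\<close> for the set \<open>I\<close> closest to \<open>G\<close> among those that beat it. Now some \<open>x \<in> G - I\<close> lies outside \<open>A\<close>,
  as \<open>G\<close> and \<open>I\<close> have the same size, and exchanging it for an element of \<open>I - G\<close>, which is of weight at most \<open>s\<close>, makes \<open>G\<close> lighter.
\<close>

lemma min_weight_basis_min_level: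
  fixes c :: "'a \<Rightarrow> nat"
  assumes fin: "\<And>G. G \<in> \<B> \<Longrightarrow> finite G" and card: "\<And>G. G \<in> \<B> \<Longrightarrow> card G = d"
    and exchange: "\<And>G H x. G \<in> \<B> \<Longrightarrow> H \<in> \<B> \<Longrightarrow> x \<in> G - H \<Longrightarrow> \<exists>y\<in>H - G. insert y (G - {x}) \<in> \<B>"
    and G: "G \<in> \<B>" and min: "\<And>H. H \<in> \<B> \<Longrightarrow> sum c G \<le> sum c H"
    and H: "H \<in> \<B>"
  shows "card (G \<inter> {i. s < c i}) \<le> card (H \<inter> {i. s < c i})"
proof (rule ccontr)
  define A where "A = {i. c i \<le> s}"
  have split: "card (I \<inter> A) + card (I \<inter> {i. s < c i}) = d" if "I \<in> \<B>" for I
  proof -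
    have "I = (I \<inter> A) \<union> (I \<inter> {i. s < c i})" by (auto simp: A_def)
    moreover have "card ((I \<inter> A) \<union> (I \<inter> {i. s < c i})) = card (I \<inter> A) + card (I \<inter> {i. s < c i})"
      by (rule card_Un_disjoint) (use fin[OF that] in \<open>auto simp: A_def\<close>)
    ultimately show ?thesis using card[OF that] by simp
  qed
  assume "\<not> ?thesis"
  then have "H \<in> \<B> \<and> card (G \<inter> A) < card (H \<inter> A)" using H split[OF G] split[OF H] by auto
  then obtain I where I: "I \<in> \<B>" and beats: "card (G \<inter> A) < card (I \<inter> A)"
    and closest: "\<And>J. J \<in> \<B> \<Longrightarrow> card (G \<inter> A) < card (J \<inter> A) \<Longrightarrow> card (I - G) \<le> card (J - G)"
    using ex_has_least_nat[of "\<lambda>I. I \<in> \<B> \<and> card (G \<inter> A) < card (I \<inter> A)" H "\<lambda>I. card (I - G)"]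
    by blast
  have IG: "I - G \<subseteq> A"
  proof (rule ccontr)
    assume "\<not> I - G \<subseteq> A"
    then obtain h where h: "h \<in> I - G" "h \<notin> A" by blast
    then obtain g where g: "g \<in> G - I" and J: "insert g (I - {h}) \<in> \<B>"
      using exchange[OF I G] by blast
    have "card (G \<inter> A) < card (insert g (I - {h}) \<inter> A)"
      using beats card_swap_Int[of I h g A] fin[OF I] h g by simp
    then have "card (I - G) \<le> card (insert g (I - {h}) - G)" using closest J by blast
    also have "insert g (I - {h}) - G = (I - G) - {h}" using g by auto
    also have "card \<dots> < card (I - G)" using h fin[OF I] by (intro card_Diff1_less) auto
    finally show False by simp
  qed
  have "card (I \<inter> {i. s < c i}) < card (G \<inter> {i. s < c i})"
    using beats split[OF G] split[OF I] by linarith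
  then have "\<not> G \<inter> {i. s < c i} \<subseteq> I \<inter> {i. s < c i}"
    using fin[OF I] by (meson card_mono finite_Int linorder_not_less)
  then obtain x where x: "x \<in> G - I" "s < c x" by blast
  then obtain y where y: "y \<in> I - G" and swap: "insert y (G - {x}) \<in> \<B>"
    using exchange[OF G I] by blast
  have "sum c (insert y (G - {x})) = c y + sum c (G - {x})"
    using fin[OF G] y by simp
  also have "\<dots> < c x + sum c (G - {x})" using x y IG by (auto simp: A_def)
  also have "\<dots> = sum c G" using fin[OF G] x by (simp add: sum.remove[of G x c])
  finally show False using min[OF swap] by simp
qed

section \<open>Membership of monomials in the cover algebra\<close>

lemma sum_single_lookup:
  "(\<Sum>m\<in>Poly_Mapping.keys p. Poly_Mapping.single m (Poly_Mapping.lookup p m)) = p"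
  by (rule poly_mapping_eqI)
    (auto simp: lookup_sum lookup_single when_def in_keys_iff)

text \<open>
  An ideal spanned by monomials is determined by the exponents that occur in it; this treats
  \<open>J\<^sub>0 = S\<close> and the span of the cover monomials uniformly. A facet is required because without
  one the vector \<open>0\<close>, which is not a cover, would satisfy the condition on the right for all \<open>k\<close>.
\<close>

lemma cover_ideal_eq:
  assumes "facets \<Delta> \<noteq> {}"
  shows "(cover_ideal n \<Delta> k :: 'k::field mpoly_nat set) =
    {p. \<forall>m\<in>Poly_Mapping.keys p. Poly_Mapping.keys m \<subseteq> {1..n} \<and>
          (\<forall>G\<in>facets \<Delta>. k \<le> (\<Sum>i\<in>G. Poly_Mapping.lookup m i))}"
    (is "_ = {p. \<forall>m\<in>Poly_Mapping.keys p. ?P m}")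
proof (cases "k = 0")
  case True
  then show ?thesis by (auto simp: cover_ideal_def poly_ring_def)
next
  case False
  have cover: "k_cover n \<Delta> k m \<longleftrightarrow> ?P m" for m
    using assms False by (auto simp: k_cover_def)
  let ?C = "{x_pow c | c. k_cover n \<Delta> k c} :: 'k mpoly_nat set"
  have "module.span scale_mpoly ?C = {p. \<forall>m\<in>Poly_Mapping.keys p. ?P m}"
  proof
    have "mpoly_vs.subspace {p :: 'k mpoly_nat. \<forall>m\<in>Poly_Mapping.keys p. ?P m}"
    proof (rule mpoly_vs.subspaceI)
      fix p q :: "'k mpoly_nat"
      assume "p \<in> {p. \<forall>m\<in>Poly_Mapping.keys p. ?P m}" "q \<in> {p. \<forall>m\<in>Poly_Mapping.keys p. ?P m}"
      then show "p + q \<in> {p. \<forall>m\<in>Poly_Mapping.keys p. ?P m}"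
        using Poly_Mapping.keys_add[of p q] by blast
    next
      fix a :: 'k and p :: "'k mpoly_nat"
      assume "p \<in> {p. \<forall>m\<in>Poly_Mapping.keys p. ?P m}"
      moreover have "Poly_Mapping.keys (scale_mpoly a p) \<subseteq> Poly_Mapping.keys p"
        by (auto simp: scale_mpoly_def in_keys_iff map.rep_eq when_def)
      ultimately show "scale_mpoly a p \<in> {p. \<forall>m\<in>Poly_Mapping.keys p. ?P m}" by blast
    qed simp
    moreover have "?C \<subseteq> {p. \<forall>m\<in>Poly_Mapping.keys p. ?P m}"
      using cover by (auto simp: x_pow_def)
    ultimately show "module.span scale_mpoly ?C \<subseteq> {p. \<forall>m\<in>Poly_Mapping.keys p. ?P m}"
      by (rule mpoly_vs.span_minimal[rotated])
  next
    show "{p. \<forall>m\<in>Poly_Mapping.keys p. ?P m} \<subseteq> module.span scale_mpoly ?C"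
    proof
      fix p :: "'k mpoly_nat"
      assume p: "p \<in> {p. \<forall>m\<in>Poly_Mapping.keys p. ?P m}"
      have "(\<Sum>m\<in>Poly_Mapping.keys p. scale_mpoly (Poly_Mapping.lookup p m) (x_pow m))
          \<in> module.span scale_mpoly ?C"
        by (intro mpoly_vs.span_sum mpoly_vs.span_scale mpoly_vs.span_base) (use p cover in auto)
      moreover have "scale_mpoly (Poly_Mapping.lookup p m) (x_pow m)
          = Poly_Mapping.single m (Poly_Mapping.lookup p m)" for m
        by (simp add: scale_mpoly_def x_pow_def)
      ultimately show "p \<in> module.span scale_mpoly ?C"
        by (simp add: sum_single_lookup)
    qed
  qed
  then show ?thesis using False by (simp add: cover_ideal_def)
qed

lemma cover_ideal_mult:
  fixes p q :: "'k::field mpoly_nat"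
  assumes "facets \<Delta> \<noteq> {}" and "p \<in> cover_ideal n \<Delta> k" "q \<in> cover_ideal n \<Delta> l"
  shows "p * q \<in> cover_ideal n \<Delta> (k + l)"
  unfolding cover_ideal_eq[OF assms(1)]
proof (intro CollectI ballI)
  fix m assume "m \<in> Poly_Mapping.keys (p * q)"
  then obtain a b where m: "m = a + b" and a: "a \<in> Poly_Mapping.keys p" and b: "b \<in> Poly_Mapping.keys q"
    using keys_mult[of p q] by blast
  have *: "Poly_Mapping.keys a \<subseteq> {1..n}" "Poly_Mapping.keys b \<subseteq> {1..n}"
    "\<forall>G\<in>facets \<Delta>. k \<le> (\<Sum>i\<in>G. Poly_Mapping.lookup a i)"
    "\<forall>G\<in>facets \<Delta>. l \<le> (\<Sum>i\<in>G. Poly_Mapping.lookup b i)"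
    using assms(2,3) a b unfolding cover_ideal_eq[OF assms(1)] by auto
  show "Poly_Mapping.keys m \<subseteq> {1..n} \<and> (\<forall>G\<in>facets \<Delta>. k + l \<le> (\<Sum>i\<in>G. Poly_Mapping.lookup m i))"
    using * Poly_Mapping.keys_add[of a b] by (auto simp: m lookup_add sum.distrib intro!: add_mono)
qed

lemma cover_ideal_add:
  fixes p q :: "'k::field mpoly_nat"
  assumes "facets \<Delta> \<noteq> {}" and "p \<in> cover_ideal n \<Delta> k" "q \<in> cover_ideal n \<Delta> k"
  shows "p + q \<in> cover_ideal n \<Delta> k"
  using assms(2,3) Poly_Mapping.keys_add[of p q] unfolding cover_ideal_eq[OF assms(1)] by blast

lemma subalgebra_cover_algebra:
  assumes "facets \<Delta> \<noteq> {}"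
  shows "subalgebra_of_poly_ring_t n (cover_algebra n \<Delta> :: 'k::field mpoly_nat poly set)"
proof -
  note eq = cover_ideal_eq[OF assms]
  have zero: "0 \<in> (cover_ideal n \<Delta> k :: 'k mpoly_nat set)" for k by (simp add: eq)
  have "f \<in> poly_ring_t n" if "f \<in> cover_algebra n \<Delta>" for f :: "'k mpoly_nat poly"
    using that by (auto simp: cover_algebra_def eq poly_ring_t_def poly_ring_def)
  moreover have "1 \<in> (cover_algebra n \<Delta> :: 'k mpoly_nat poly set)"
  proof -
    have "1 \<in> (cover_ideal n \<Delta> 0 :: 'k mpoly_nat set)"
      by (simp add: eq flip: single_one)
    then show ?thesis using zero by (auto simp: cover_algebra_def coeff_1)
  qed
  moreover have "f + g \<in> cover_algebra n \<Delta>"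
    if "f \<in> cover_algebra n \<Delta>" "g \<in> cover_algebra n \<Delta>" for f g :: "'k mpoly_nat poly"
    using that by (simp add: cover_algebra_def cover_ideal_add[OF assms])
  moreover have "f * g \<in> cover_algebra n \<Delta>"
    if "f \<in> cover_algebra n \<Delta>" "g \<in> cover_algebra n \<Delta>" for f g :: "'k mpoly_nat poly"
  proof -
    have sums: "sum h I \<in> cover_ideal n \<Delta> k"
      if "\<And>i. i \<in> I \<Longrightarrow> h i \<in> cover_ideal n \<Delta> k" for h :: "nat \<Rightarrow> 'k mpoly_nat" and I k
      using that by (induction I rule: infinite_finite_induct) (simp_all add: zero cover_ideal_add[OF assms])
    have "coeff f i * coeff g (k - i) \<in> cover_ideal n \<Delta> k" if "i \<le> k" for i k
      using cover_ideal_mult[OF assms, of "coeff f i" n i "coeff g (k - i)" "k - i"] that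
        \<open>f \<in> cover_algebra n \<Delta>\<close> \<open>g \<in> cover_algebra n \<Delta>\<close> by (simp add: cover_algebra_def)
    then show ?thesis by (auto simp: cover_algebra_def coeff_mult intro!: sums)
  qed
  moreover have "smult a f \<in> cover_algebra n \<Delta>"
    if "a \<in> poly_ring n" "f \<in> cover_algebra n \<Delta>" for a and f :: "'k mpoly_nat poly"
    using that cover_ideal_mult[OF assms, of a n 0]
    by (auto simp: cover_algebra_def cover_ideal_def[of n \<Delta> 0])
  ultimately show ?thesis unfolding subalgebra_of_poly_ring_t_def by blast
qed

text \<open>
  Since a subalgebra is closed under sums and contains the multiples of its elements by scalars, containment of
  \<open>A(\<Delta>)\<close> is decided by the monomials \<open>x\<^sup>c t\<^sup>k\<close>.
\<close>

lemma cover_algebra_subset: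
  fixes X :: "'k::field mpoly_nat poly set"
  assumes "facets \<Delta> \<noteq> {}" and X: "subalgebra_of_poly_ring_t n X"
    and monomials: "\<And>c k. Poly_Mapping.keys c \<subseteq> {1..n} \<Longrightarrow>
      (\<And>G. G \<in> facets \<Delta> \<Longrightarrow> k \<le> (\<Sum>i\<in>G. Poly_Mapping.lookup c i)) \<Longrightarrow> monom (x_pow c) k \<in> X"
  shows "cover_algebra n \<Delta> \<subseteq> X"
proof
  have const: "a \<in> poly_ring n \<Longrightarrow> f \<in> X \<Longrightarrow> smult a f \<in> X" and one: "1 \<in> X" for a f
    using X by (auto simp: subalgebra_of_poly_ring_t_def)
  have "0 \<in> X" using const[of 0 1] one by (simp add: poly_ring_def)
  then have sums: "(\<And>i. i \<in> I \<Longrightarrow> h i \<in> X) \<Longrightarrow> sum h I \<in> X" for h and I :: "'i set"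
    using X by (induction I rule: infinite_finite_induct) (auto simp: subalgebra_of_poly_ring_t_def)
  fix f :: "'k mpoly_nat poly" assume f: "f \<in> cover_algebra n \<Delta>"
  have "monom (coeff f k) k \<in> X" for k
  proof -
    have "monom (Poly_Mapping.single m (Poly_Mapping.lookup (coeff f k) m)) k \<in> X"
      if "m \<in> Poly_Mapping.keys (coeff f k)" for m
    proof -
      let ?a = "Poly_Mapping.single 0 (Poly_Mapping.lookup (coeff f k) m)"
      have "coeff f k \<in> cover_ideal n \<Delta> k" using f by (simp add: cover_algebra_def)
      then have "monom (x_pow m) k \<in> X"
        using that by (intro monomials) (auto simp: cover_ideal_eq[OF assms(1)])
      then have "smult ?a (monom (x_pow m) k) \<in> X"
        by (rule const[rotated]) (simp add: poly_ring_def)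
      then show ?thesis by (simp add: x_pow_def smult_monom mult_single)
    qed
    then have "(\<Sum>m\<in>Poly_Mapping.keys (coeff f k).
        monom (Poly_Mapping.single m (Poly_Mapping.lookup (coeff f k) m)) k) \<in> X"
      by (rule sums)
    then show ?thesis
      by (simp add: sum_single_lookup flip: monom_sum)
  qed
  then have "(\<Sum>k\<le>degree f. monom (coeff f k) k) \<in> X" by (intro sums)
  then show "f \<in> X" by (simp add: poly_as_sum_of_monoms)
qed

section \<open>Decomposition into squarefree covers\<close>

definition level_vec :: "(nat \<Rightarrow>\<^sub>0 nat) \<Rightarrow> nat \<Rightarrow> (nat \<Rightarrow>\<^sub>0 nat)" where
  "level_vec c s = Poly_Mapping.map (\<lambda>v. of_bool (s < v)) c"

lemma lookup_level_vec:
  "Poly_Mapping.lookup (level_vec c s) i = of_bool (s < Poly_Mapping.lookup c i)"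
  by (auto simp: level_vec_def map.rep_eq when_def)

lemma keys_level_vec: "Poly_Mapping.keys (level_vec c s) \<subseteq> Poly_Mapping.keys c"
  by (auto simp: in_keys_iff lookup_level_vec)

lemma sum_level_vec:
  "finite G \<Longrightarrow> (\<Sum>i\<in>G. Poly_Mapping.lookup (level_vec c s) i)
    = card (G \<inter> {i. s < Poly_Mapping.lookup c i})"
  by (simp add: lookup_level_vec sum_of_bool_eq)

lemma sum_of_bool_less:
  fixes v M :: nat
  shows "(\<Sum>s<M. of_bool (s < v)) = min v M"
  by (induction M) auto

lemma level_vec_decomposition:
  assumes "\<And>i. Poly_Mapping.lookup c i \<le> M"
  shows "(\<Sum>s<M. level_vec c s) = c"
  by (rule poly_mapping_eqI)
    (simp add: lookup_sum lookup_level_vec sum_of_bool_less assms del: sum_of_bool_eq)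

text \<open>
  A vector of order \<open>d\<close> is a cover of every smaller degree as well, so the degrees of the factors
  can be chosen to add up to exactly \<open>k\<close>.
\<close>

lemma monom_sum_in_subalgebra:
  fixes X :: "'k::field mpoly_nat poly set"
  assumes X: "subalgebra_of_poly_ring_t n X"
    and factors: "\<And>s k. k \<le> d s \<Longrightarrow> monom (x_pow (e s)) k \<in> X"
  shows "k \<le> (\<Sum>s<M. d s) \<Longrightarrow> monom (x_pow (\<Sum>s<(M::nat). e s)) k \<in> X"
proof (induction M arbitrary: k)
  case 0
  then show ?case
    using X by (simp add: subalgebra_of_poly_ring_t_def x_pow_def flip: one_poly_eq_simps)
next
  case (Suc M)
  define k1 where "k1 = min k (\<Sum>s<M. d s)"
  have "monom (x_pow (\<Sum>s<M. e s)) k1 \<in> X" by (intro Suc.IH) (simp add: k1_def)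
  moreover have "monom (x_pow (e M)) (k - k1) \<in> X"
    using Suc.prems by (intro factors) (auto simp: k1_def)
  ultimately have "monom (x_pow (\<Sum>s<M. e s)) k1 * monom (x_pow (e M)) (k - k1) \<in> X"
    using X by (simp add: subalgebra_of_poly_ring_t_def)
  moreover have "k1 \<le> k" by (simp add: k1_def)
  ultimately show ?case by (simp add: mult_monom x_pow_def mult_single)
qed

text \<open>
  A facet \<open>G\<close> of minimal weight \<open>c\<close> minimizes all level vectors of \<open>c\<close>, so the orders of these add
  up to \<open>c(G)\<close>, which is the order of \<open>c\<close>.
\<close>

lemma cover_monom_in_subalgebra:
  fixes X :: "'k::field mpoly_nat poly set"
  assumes F: "F \<subseteq> {1..n}" and facets: "facets \<Delta> = principal_borel n F"
    and X: "subalgebra_of_poly_ring_t n X"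
    and gens: "\<And>c k. 1 \<le> k \<Longrightarrow> k_cover n \<Delta> k c \<Longrightarrow> squarefree_vec c \<Longrightarrow> monom (x_pow c) k \<in> X"
    and c: "Poly_Mapping.keys c \<subseteq> {1..n}"
    and k: "\<And>G. G \<in> facets \<Delta> \<Longrightarrow> k \<le> (\<Sum>i\<in>G. Poly_Mapping.lookup c i)"
  shows "monom (x_pow c) k \<in> X"
proof -
  have \<B>: "facets \<Delta> = dominating n F" using facets F by (simp add: principal_borel_eq_dominating)
  have "F \<in> facets \<Delta>" using F by (simp add: \<B> dominating_def)
  then obtain G where G: "G \<in> facets \<Delta>"
    and min: "\<And>H. H \<in> facets \<Delta> \<Longrightarrow> sum (Poly_Mapping.lookup c) G \<le> sum (Poly_Mapping.lookup c) H"
    using ex_has_least_nat[of "\<lambda>H. H \<in> facets \<Delta>" F "sum (Poly_Mapping.lookup c)"] by blast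
  have fin: "finite H" if "H \<in> facets \<Delta>" for H using that finite_dominating \<B> by simp
  define d where "d s = (\<Sum>i\<in>G. Poly_Mapping.lookup (level_vec c s) i)" for s
  have order: "d s \<le> (\<Sum>i\<in>H. Poly_Mapping.lookup (level_vec c s) i)" if "H \<in> facets \<Delta>" for s H
    unfolding d_def sum_level_vec[OF fin[OF G]] sum_level_vec[OF fin[OF that]]
  proof (rule min_weight_basis_min_level[OF _ _ _ G min that])
    show "card H = card F" if "H \<in> facets \<Delta>" for H using that by (simp add: \<B> dominating_def)
    show "\<exists>y\<in>I - H. insert y (H - {x}) \<in> facets \<Delta>"
      if "H \<in> facets \<Delta>" "I \<in> facets \<Delta>" "x \<in> H - I" for H I x
      using that unfolding \<B> by (rule dominating_exchange)
  qed (rule fin)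
  have factors: "monom (x_pow (level_vec c s)) l \<in> X" if "l \<le> d s" for s l
  proof (cases "l = 0")
    case True
    have "x_pow (level_vec c s) \<in> (poly_ring n :: 'k mpoly_nat set)"
      using c keys_level_vec[of c s] by (auto simp: poly_ring_def x_pow_def)
    then have "smult (x_pow (level_vec c s)) 1 \<in> X"
      using X unfolding subalgebra_of_poly_ring_t_def by blast
    then show ?thesis by (simp add: True monom_0)
  next
    case False
    have "level_vec c s \<noteq> 0" using that False by (auto simp: d_def)
    moreover have "squarefree_vec (level_vec c s)" by (simp add: squarefree_vec_def lookup_level_vec)
    ultimately show ?thesis
      using False that c keys_level_vec[of c s] order[of _ s]
      by (intro gens) (auto simp: k_cover_def intro: order_trans)
  qed
  define M where "M = Max (insert 0 (Poly_Mapping.lookup c ` Poly_Mapping.keys c))"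
  have "Poly_Mapping.lookup c i \<le> M" for i
    by (cases "i \<in> Poly_Mapping.keys c") (auto simp: M_def in_keys_iff)
  then have decomposition: "(\<Sum>s<M. level_vec c s) = c" by (rule level_vec_decomposition)
  have "(\<Sum>s<M. d s) = (\<Sum>i\<in>G. Poly_Mapping.lookup (\<Sum>s<M. level_vec c s) i)"
    by (simp add: d_def lookup_sum sum.swap[of _ G])
  then have "k \<le> (\<Sum>s<M. d s)" using k[OF G] by (simp add: decomposition)
  then have "monom (x_pow (\<Sum>s<M. level_vec c s)) k \<in> X"
    using factors by (rule monom_sum_in_subalgebra[OF X, rotated])
  then show ?thesis by (simp add: decomposition)
qed

theorem theorem3p5:
  fixes n :: nat and F :: "nat set" and \<Delta> :: "nat set set"
  assumes "F \<subseteq> {1..n}"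
    and "simplicial_complex_on n \<Delta>"
    and "facets \<Delta> = principal_borel n F"
  shows "(squarefree_cover_algebra n \<Delta> :: 'k::field mpoly_nat poly set) = cover_algebra n \<Delta>"
proof
  have ne: "facets \<Delta> \<noteq> {}"
    using assms(1,3) hull_subset[of "{F}" "borel_set n"] by (auto simp: principal_borel_def)
  let ?gens = "{monom (x_pow c) k | c k. 1 \<le> k \<and> k_cover n \<Delta> k c \<and> squarefree_vec c}
    :: 'k mpoly_nat poly set"
  have "?gens \<subseteq> cover_algebra n \<Delta>"
    by (auto simp: cover_algebra_def cover_ideal_eq[OF ne] k_cover_def x_pow_def split: if_splits)
  then show "squarefree_cover_algebra n \<Delta> \<subseteq> (cover_algebra n \<Delta> :: 'k mpoly_nat poly set)"
    unfolding squarefree_cover_algebra_def by (intro hull_minimal subalgebra_cover_algebra ne)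
  have "cover_algebra n \<Delta> \<subseteq> X" if X: "subalgebra_of_poly_ring_t n X" and "?gens \<subseteq> X" for X
  proof (rule cover_algebra_subset[OF ne X])
    show "monom (x_pow c) k \<in> X"
      if "Poly_Mapping.keys c \<subseteq> {1..n}"
        "\<And>G. G \<in> facets \<Delta> \<Longrightarrow> k \<le> (\<Sum>i\<in>G. Poly_Mapping.lookup c i)" for c k
      by (rule cover_monom_in_subalgebra[OF assms(1,3) X _ that]) (use \<open>?gens \<subseteq> X\<close> in blast)
  qed
  then show "cover_algebra n \<Delta> \<subseteq> (squarefree_cover_algebra n \<Delta> :: 'k mpoly_nat poly set)"
    unfolding squarefree_cover_algebra_def hull_def by blast
qed

end
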